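(* Let $\nu$ be a lattice path, let $N_\nu(x)$ be its $\nu$-Narayana polynomial, and let $\mathtt{sch}_\nu(i)$ denote the number of $\nu$-Schröder paths with exactly $i$ diagonal steps. Then $$N_\nu(x+1) = \sum_{i\geq 0} \mathtt{sch}_\nu(i)\, x^i.$$
   Context: A lattice path from $(0,0)$ to $(b,a)\in\mathbb{Z}_{\ge 0}^2$ is a sequence of $a$ north steps $N=(0,1)$ and $b$ east steps $E=(1,0)$. Let $\nu$ be such a path. A $\nu$-Dyck path is a lattice path from $(0,0)$ to $(b,a)$ which stays weakly above $\nu$. A $\nu$-Schröder path is a path from $(0,0)$ to $(b,a)$ with steps $N=(0,1)$, $E=(1,0)$, $D=(1,1)$ (diagonal) which stays weakly above $\nu$. A valley of a lattice path is a consecutive pair $EN$ of steps. The $i$-th $\nu$-Narayana number $\mathtt{Nar}_\nu(i)$ is the number of $\nu$-Dyck paths with exactly $i$ valleys, and the $\nu$-Narayana polynomial is $N_\nu(x)=\sum_{i\ge 0}\mathtt{Nar}_\nu(i)x^i$. *)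

theory Defs
  imports
    "HOL-Analysis.Analysis"
    "HOL-Computational_Algebra.Polynomial"
    "HOL-Library.Groups_Big_Fun"
begin

text \<open>Paths start at the origin and are encoded by their words of steps.\<close>

datatype step = North | East | Diag

primrec step_vec :: "step \<Rightarrow> real \<times> real" where
  "step_vec North = (0, 1)"
| "step_vec East = (1, 0)"
| "step_vec Diag = (1, 1)"

definition endpoint :: "step list \<Rightarrow> real \<times> real" where
  "endpoint w = sum_list (map step_vec w)"

text \<open>The plane curve drawn by a word of steps, starting at a given point.\<close>

primrec trace_from :: "real \<times> real \<Rightarrow> step list \<Rightarrow> (real \<times> real) set" where
  "trace_from p [] = {p}"
| "trace_from p (s # w) = closed_segment p (p + step_vec s) \<union> trace_from (p + step_vec s) w"

text \<open>
  The whole curves are compared, not just their lattice points: if \<open>\<nu>\<close> turns at a corner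
  \<open>North, East\<close>, a diagonal step joining the two outer ends of that corner has both its ends
  on \<open>\<nu>\<close>, but it runs strictly below \<open>\<nu>\<close> in between.
  On a vertical line met by \<open>\<nu>\<close> in a whole segment, every point of that segment (and every
  point above it) is weakly above \<open>\<nu>\<close>.
\<close>

definition weakly_above :: "step list \<Rightarrow> step list \<Rightarrow> bool" where
  "weakly_above w \<nu> \<longleftrightarrow>
     (\<forall>(x, y) \<in> trace_from (0, 0) w. \<exists>y'\<le>y. (x, y') \<in> trace_from (0, 0) \<nu>)"

definition lattice_path :: "step list \<Rightarrow> bool" where
  "lattice_path w \<longleftrightarrow> set w \<subseteq> {North, East}"

definition dyck_paths :: "step list \<Rightarrow> step list set" where
  "dyck_paths \<nu> = {w. lattice_path w \<and> endpoint w = endpoint \<nu> \<and> weakly_above w \<nu>}"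

definition schroeder_paths :: "step list \<Rightarrow> step list set" where
  "schroeder_paths \<nu> = {w. endpoint w = endpoint \<nu> \<and> weakly_above w \<nu>}"

definition valleys :: "step list \<Rightarrow> nat" where
  "valleys w = card {k. Suc k < length w \<and> w ! k = East \<and> w ! Suc k = North}"

definition narayana :: "step list \<Rightarrow> nat \<Rightarrow> nat" where
  "narayana \<nu> i = card {w \<in> dyck_paths \<nu>. valleys w = i}"

definition schroeder :: "step list \<Rightarrow> nat \<Rightarrow> nat" where
  "schroeder \<nu> i = card {w \<in> schroeder_paths \<nu>. count_list w Diag = i}"

text \<open>
  \<^const>\<open>Sum_any\<close> is the sum over all \<open>i\<close> with a nonzero term. The lemmas at the end show
  that the path sets are finite and that both sums have finite support, so that the default
  values of \<^const>\<open>card\<close> and \<^const>\<open>Sum_any\<close> for infinite sets play no role.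
\<close>

definition narayana_poly :: "step list \<Rightarrow> int poly" where
  "narayana_poly \<nu> = Sum_any (\<lambda>i. monom (int (narayana \<nu> i)) i)"

lemma length_le_endpoint: "real (length w) \<le> fst (endpoint w) + snd (endpoint w)"
proof (induction w)
  case Nil
  then show ?case by (simp add: endpoint_def)
next
  case (Cons s w)
  then show ?case by (cases s) (simp_all add: endpoint_def)
qed

lemma finite_schroeder_paths: "finite (schroeder_paths \<nu>)"
proof -
  define n where "n = nat \<lceil>fst (endpoint \<nu>) + snd (endpoint \<nu>)\<rceil>"
  have "length w \<le> n" if "w \<in> schroeder_paths \<nu>" for w
    using that length_le_endpoint[of w] unfolding schroeder_paths_def n_def
    by simp linarith
  then have "schroeder_paths \<nu> \<subseteq> {w. set w \<subseteq> {North, East, Diag} \<and> length w \<le> n}"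
    using step.exhaust by blast
  then show ?thesis
    using finite_lists_length_le[of "{North, East, Diag}" n] finite_subset by blast
qed

lemma finite_dyck_paths: "finite (dyck_paths \<nu>)"
  by (rule finite_subset[OF _ finite_schroeder_paths[of \<nu>]])
    (auto simp: dyck_paths_def schroeder_paths_def)

lemma finite_support_card_fibres:
  assumes "finite A"
  shows "finite {i. card {w \<in> A. f w = i} \<noteq> 0}"
proof -
  have "{i. card {w \<in> A. f w = i} \<noteq> 0} \<subseteq> f ` A"
  proof
    fix i assume "i \<in> {i. card {w \<in> A. f w = i} \<noteq> 0}"
    then have "{w \<in> A. f w = i} \<noteq> {}" by force
    then show "i \<in> f ` A" by blast
  qed
  then show ?thesis
    using assms finite_subset by blast
qed

lemma coeff_Sum_any_monom:
  fixes c :: "nat \<Rightarrow> nat"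
  assumes "finite {i. c i \<noteq> 0}"
  shows "coeff (Sum_any (\<lambda>i. monom (int (c i)) i)) j = int (c j)"
proof -
  have "Sum_any (\<lambda>i. monom (int (c i)) i) = (\<Sum>i | c i \<noteq> 0. monom (int (c i)) i)"
    using assms by (simp add: Sum_any.expand_set)
  then show ?thesis
    using assms by (simp add: coeff_sum coeff_monom)
qed

lemma coeff_narayana_poly: "coeff (narayana_poly \<nu>) i = int (narayana \<nu> i)"
  unfolding narayana_poly_def
  by (rule coeff_Sum_any_monom)
    (simp only: narayana_def finite_support_card_fibres[OF finite_dyck_paths])

lemma coeff_schroeder_sum:
  "coeff (Sum_any (\<lambda>i. monom (int (schroeder \<nu> i)) i)) j = int (schroeder \<nu> j)"
  by (rule coeff_Sum_any_monom)
    (simp only: schroeder_def finite_support_card_fibres[OF finite_schroeder_paths])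

end

theory Submission
  imports Defs
begin

text \<open>
  Replacing every diagonal step by \<open>East, North\<close> turns a Schroeder path into a Dyck path, and the
  Schroeder paths over a given Dyck path correspond to the subsets of its valleys, a subset
  marking the valleys to be cut off by a diagonal. Hence a Dyck path with \<open>v\<close> valleys accounts
  for \<open>(1 + x) ^ v\<close> on the Schroeder side. The replacement respects being weakly above \<open>\<nu>\<close>: as
  \<open>\<nu>\<close> crosses each vertical unit strip at an integer height, a lattice unit square lies weakly
  above \<open>\<nu>\<close> as soon as its centre (a point of the diagonal) or the midpoint of its bottom side
  (a point of \<open>East, North\<close>) does.
\<close>

primrec expand :: "step list \<Rightarrow> step list" where
  "expand [] = []"
| "expand (s # w) = (case s of Diag \<Rightarrow> [East, North] | _ \<Rightarrow> [s]) @ expand w"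

lemma lattice_path_expand: "lattice_path (expand w)"
  unfolding lattice_path_def by (induction w) (auto split: step.splits)

lemma endpoint_expand: "endpoint (expand w) = endpoint w"
  unfolding endpoint_def by (induction w) (auto split: step.splits simp flip: add.assoc)

text \<open>Turns the comparison with \<open>\<nu>\<close> into a subset relation, which splits over
  the segments of a path.\<close>

definition upset :: "step list \<Rightarrow> (real \<times> real) set" where
  "upset \<nu> = {(x, y). \<exists>y'\<le>y. (x, y') \<in> trace_from (0, 0) \<nu>}"

lemma weakly_above_iff_subset_upset: "weakly_above w \<nu> \<longleftrightarrow> trace_from (0, 0) w \<subseteq> upset \<nu>"
  unfolding weakly_above_def upset_def by blast

text \<open>A half-integer abscissa is met neither by a north step nor by an integer point, so the
  point lies on an east step, all of which has the same height. The start is an arbitrary integer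
  point because the induction moves it.\<close>

lemma trace_from_strip:
  fixes a b i :: int and y :: real
  assumes "lattice_path \<nu>" "(i + 1 / 2, y) \<in> trace_from (of_int a, of_int b) \<nu>"
  obtains h :: int where "y = h"
    "{real_of_int i..of_int i + 1} \<times> {real_of_int h} \<subseteq> trace_from (of_int a, of_int b) \<nu>"
proof -
  have "\<exists>h::int. y = h \<and> {real_of_int i..of_int i + 1} \<times> {real_of_int h} \<subseteq> trace_from (of_int a, of_int b) \<nu>"
    using assms
  proof (induction \<nu> arbitrary: a b)
    case Nil
    \<comment> \<open>Clearing the half leaves an equation of integers, refuted by parity.\<close>
    then have "2 * i + 1 = 2 * a"
      by simp
    then show ?case by presburger
  next
    case (Cons s \<nu>)
    have lp: "lattice_path \<nu>" and s: "s = North \<or> s = East"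
      using Cons.prems(1) by (auto simp: lattice_path_def)
    obtain a' b' :: int where p: "(real_of_int a, real_of_int b) + step_vec s = (of_int a', of_int b')"
      using s that[of a "b + 1"] that[of "a + 1" b] by auto
    show ?case
    proof (cases "(i + 1 / 2, y) \<in> trace_from (of_int a', of_int b') \<nu>")
      case True
      from Cons.IH[OF lp this] show ?thesis by (auto simp: p)
    next
      case False
      then have seg: "(i + 1 / 2, y) \<in> closed_segment (of_int a, of_int b) ((of_int a, of_int b) + step_vec s)"
        using Cons.prems(2) by (simp add: p)
      have "s \<noteq> North"
      proof
        assume "s = North"
        with seg have "2 * i + 1 = 2 * a"
          by (auto simp: closed_segment_same_fst)
        then show False by presburger
      qed
      with s have [simp]: "s = East" by simp
      from seg have y: "y = b" and ia: "a \<le> i + 1 / 2" "i + 1 / 2 \<le> a + (1::real)"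
        by (auto simp: closed_segment_same_snd closed_segment_eq_real_ivl)
      then have "i = a" by linarith
      then show ?thesis using y
        by (intro exI[of _ b]) (auto simp: closed_segment_same_snd closed_segment_eq_real_ivl)
    qed
  qed
  then show ?thesis using that by blast
qed

text \<open>By \<open>trace_from_strip\<close>, \<open>\<nu>\<close> crosses the strip along an east
  step at an integer height \<open>h \<le> y < j + 1\<close>. Hence \<open>h \<le> j\<close>, so
  that step runs at or below the bottom side of the square.\<close>

lemma unit_square_subset_upset:
  fixes i j :: int and y :: real
  assumes "lattice_path \<nu>" "(i + 1 / 2, y) \<in> upset \<nu>" "y < of_int j + 1"
  shows "{real_of_int i..of_int i + 1} \<times> {real_of_int j..of_int j + 1} \<subseteq> upset \<nu>"
proof -
  obtain y' where y': "y' \<le> y" "(i + 1 / 2, y') \<in> trace_from (0, 0) \<nu>"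
    using assms(2) by (auto simp: upset_def)
  obtain h :: int where h: "y' = h" "{real_of_int i..of_int i + 1} \<times> {real_of_int h} \<subseteq> trace_from (0, 0) \<nu>"
    using trace_from_strip[OF assms(1), of i y' 0 0] y'(2) by auto
  have "h < j + 1" using h(1) y'(1) assms(3) by linarith
  then have "real_of_int h \<le> j" by simp
  then have "real_of_int h \<le> t" if "j \<le> t" for t :: real using that by linarith
  then show ?thesis using h(2) unfolding upset_def subset_iff by auto
qed

lemma trace_from_expand_subset_iff:
  fixes i j :: int
  assumes "lattice_path \<nu>"
  shows "trace_from (of_int i, of_int j) (expand w) \<subseteq> upset \<nu>
     \<longleftrightarrow> trace_from (of_int i, of_int j) w \<subseteq> upset \<nu>"
proof (induction w arbitrary: i j)
  case (Cons s w)
  show ?case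
  proof (cases s)
    case North
    with Cons.IH[of i "j + 1"] show ?thesis by simp
  next
    case East
    with Cons.IH[of "i + 1" j] show ?thesis by simp
  next
    case Diag
    define p :: "real \<times> real" where "p = (of_int i, of_int j)"
    let ?Q = "{real_of_int i..of_int i + 1} \<times> {real_of_int j..of_int j + 1}"
    let ?D = "closed_segment p (p + (1, 1))"
    let ?EN = "closed_segment p (p + (1, 0)) \<union> closed_segment (p + (1, 0)) (p + (1, 1))"
    have "convex ?Q" by (intro convex_Times convex_real_interval)
    then have sub: "?D \<subseteq> ?Q" "?EN \<subseteq> ?Q"
      by (intro Un_least closed_segment_subset; simp add: p_def)+
    have "midpoint p (p + (1, 1)) = (i + 1 / 2, j + 1 / 2)" "midpoint p (p + (1, 0)) = (i + 1 / 2, j)"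
      by (auto simp: p_def midpoint_def field_simps)
    then have "(i + 1 / 2, j + 1 / 2) \<in> ?D" "(i + 1 / 2, real_of_int j) \<in> ?EN"
      using midpoint_in_closed_segment[of p "p + (1, 1)"] midpoint_in_closed_segment[of p "p + (1, 0)"]
      by simp_all
    \<comment> \<open>The witness is the centre for \<open>?D\<close> and the midpoint of the bottom
      side for \<open>?EN\<close>; both have height less than \<open>j + 1\<close>.\<close>
    then have "?Q \<subseteq> upset \<nu>" if "?D \<subseteq> upset \<nu> \<or> ?EN \<subseteq> upset \<nu>"
      using that unit_square_subset_upset[OF assms, of i "j + 1 / 2" j]
        unit_square_subset_upset[OF assms, of i j j]
      by (auto dest: subsetD simp del: Un_subset_iff Un_iff)
    then have "?D \<subseteq> upset \<nu> \<longleftrightarrow> ?EN \<subseteq> upset \<nu>"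
      using sub by (meson subset_trans)
    then show ?thesis
      using Diag Cons.IH[of "i + 1" "j + 1"] by (simp add: p_def Un_assoc)
  qed
qed simp

text \<open>Schroeder paths are thus the full preimage of the Dyck paths under
  \<open>expand\<close>, which allows counting by fibres.\<close>

lemma schroeder_paths_iff_expand:
  assumes "lattice_path \<nu>"
  shows "w \<in> schroeder_paths \<nu> \<longleftrightarrow> expand w \<in> dyck_paths \<nu>"
  using trace_from_expand_subset_iff[OF assms, of 0 0 w]
  by (simp add: schroeder_paths_def dyck_paths_def lattice_path_expand endpoint_expand
      weakly_above_iff_subset_upset)

text \<open>Old valley positions shift by \<open>Suc\<close>; only position 0 can be new.\<close>

lemma valleys_Cons:
  "valleys (s # w) = (if s = East \<and> w \<noteq> [] \<and> hd w = North then 1 else 0) + valleys w"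
proof -
  let ?V = "\<lambda>w. {k. Suc k < length w \<and> w ! k = East \<and> w ! Suc k = North}"
  have V: "?V (s # w) = (if s = East \<and> w \<noteq> [] \<and> hd w = North then {0} else {}) \<union> Suc ` ?V w"
    (is "?L = ?R")
  proof (rule set_eqI)
    show "k \<in> ?L \<longleftrightarrow> k \<in> ?R" for k
      by (cases k) (auto simp: hd_conv_nth)
  qed
  have fin: "finite (?V w)" by (rule finite_subset[of _ "{..<length w}"]) auto
  show ?thesis
    unfolding valleys_def V using fin by (subst card_Un_disjoint) (auto simp: card_image)
qed

lemma expand_eq_Nil_iff: "expand w = [] \<longleftrightarrow> w = []"
  by (cases w) (auto split: step.splits)

lemma expand_eq_North_iff: "expand w = North # v \<longleftrightarrow> (\<exists>w'. w = North # w' \<and> expand w' = v)"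
  by (cases w) (auto split: step.splits)

lemma expand_eq_East_iff:
  "expand w = East # v \<longleftrightarrow> (\<exists>w'. w = East # w' \<and> expand w' = v)
     \<or> (\<exists>w'. w = Diag # w' \<and> v = North # expand w')"
  by (cases w) (auto split: step.splits)

text \<open>Expansion never shortens a word. Finiteness is what permits splitting the sum over a
  fibre.\<close>

lemma finite_expand_fibre: "finite {w. expand w = v}"
proof -
  have "length w \<le> length (expand w)" for w
    by (induction w) (auto split: step.splits)
  then have "{w. expand w = v} \<subseteq> {w. set w \<subseteq> {North, East, Diag} \<and> length w \<le> length v}"
    using step.exhaust by blast
  then show ?thesis
    using finite_lists_length_le[of "{North, East, Diag}" "length v"] finite_subset by blast
qed

text \<open>Each valley of \<open>v\<close> comes from either \<open>East, North\<close> or a single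
  \<open>Diag\<close>, independently of the others, and contributes a factor \<open>1 + x\<close>;
  all other letters have a unique origin.\<close>

lemma sum_expand_fibre:
  fixes x :: "'a::comm_semiring_1"
  assumes "lattice_path v"
  shows "(\<Sum>w | expand w = v. x ^ count_list w Diag) = (1 + x) ^ valleys v"
  using assms
proof (induction v rule: length_induct)
  case (1 v)
  have IH: "(\<Sum>w | expand w = u. x ^ count_list w Diag) = (1 + x) ^ valleys u"
    if "length u < length v" "set u \<subseteq> set v" for u
    using 1 that by (auto simp: lattice_path_def)
  have shift: "(\<Sum>w \<in> (#) s ` {w. expand w = u}. x ^ count_list w Diag)
      = x ^ (if s = Diag then 1 else 0) * (\<Sum>w | expand w = u. x ^ count_list w Diag)" for s u
    by (subst sum.reindex) (auto simp: sum_distrib_left)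
  \<comment> \<open>The first two letters decide; \<open>remdups_adj.cases\<close> serves only to
    separate empty, one-letter and longer lists.\<close>
  consider (Nil) "v = []" | (North) u where "v = North # u" | (EN) u where "v = East # North # u"
    | (East) u where "v = East # u" "u = [] \<or> hd u \<noteq> North"
    using 1(2) by (cases v rule: remdups_adj.cases) (auto simp: lattice_path_def)
  then show ?case
  proof cases
    case Nil
    then show ?thesis by (simp add: expand_eq_Nil_iff valleys_def)
  next
    case North
    then have "{w. expand w = v} = (#) North ` {w. expand w = u}"
      by (auto simp: expand_eq_North_iff)
    then show ?thesis
      using IH[of u] North by (auto simp: shift valleys_Cons)
  next
    case EN
    then have fibre: "{w. expand w = v}
        = (#) East ` {w. expand w = North # u} \<union> (#) Diag ` {w. expand w = u}"
      by (auto simp: expand_eq_East_iff)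
    \<comment> \<open>\<open>North # u\<close> has as many valleys as \<open>u\<close>, so the two
      parts sum to \<open>(1 + x) ^ valleys u\<close> and \<open>x\<close> times it.\<close>
    show ?thesis
      unfolding fibre using IH[of u] IH[of "North # u"] EN
      by (subst sum.union_disjoint)
        (auto simp: finite_expand_fibre shift valleys_Cons distrib_right subset_insertI2)
  next
    case East
    \<comment> \<open>An initial \<open>Diag\<close> would force \<open>North\<close> as the second
      letter of \<open>v\<close>.\<close>
    then have "{w. expand w = v} = (#) East ` {w. expand w = u}"
      by (auto simp: expand_eq_East_iff)
    then show ?thesis
      using IH[of u] East by (auto simp: shift valleys_Cons)
  qed
qed

lemma pcompose_power: "pcompose (p ^ n) q = pcompose p q ^ n"
  for p q :: "'a::comm_semiring_1 poly"
  by (induction n) (simp_all add: pcompose_1 pcompose_mult)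

text \<open>Each path contributes one power of the variable, so counting polynomials become sums
  over paths that can be regrouped.\<close>

lemma Sum_any_monom_card_fibres:
  assumes "finite A"
  shows "Sum_any (\<lambda>i. monom (int (card {w \<in> A. f w = i})) i) = (\<Sum>w\<in>A. monom 1 1 ^ f w)"
proof (rule poly_eqI)
  fix j
  have "int (card {w \<in> A. f w = j}) = (\<Sum>w\<in>A. if f w = j then 1 else 0)"
    using assms by (simp add: sum.If_cases Collect_conj_eq)
  then show "coeff (Sum_any (\<lambda>i. monom (int (card {w \<in> A. f w = i})) i)) j
      = coeff (\<Sum>w\<in>A. monom 1 1 ^ f w) j"
    by (simp add: coeff_Sum_any_monom[OF finite_support_card_fibres[OF assms]] coeff_sum monom_power)
qed

theorem proposition2p6:
  fixes \<nu> :: "step list"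
  assumes "lattice_path \<nu>"
  shows "pcompose (narayana_poly \<nu>) [:1, 1:] = Sum_any (\<lambda>i. monom (int (schroeder \<nu> i)) i)"
proof -
  let ?x = "monom 1 1 :: int poly"
  have "pcompose (narayana_poly \<nu>) [:1, 1:] = (\<Sum>v\<in>dyck_paths \<nu>. (1 + ?x) ^ valleys v)"
    unfolding narayana_poly_def narayana_def Sum_any_monom_card_fibres[OF finite_dyck_paths]
    by (simp add: pcompose_sum pcompose_power monom_Suc monom_0 pcompose_pCons one_pCons)
  also have "\<dots> = (\<Sum>v\<in>dyck_paths \<nu>. \<Sum>w | expand w = v. ?x ^ count_list w Diag)"
    by (intro sum.cong refl sum_expand_fibre[symmetric]) (simp add: dyck_paths_def)
  \<comment> \<open>Every word in the fibre over a Dyck path is a Schroeder path; this is the form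
    in which \<open>sum.group\<close> merges the fibres.\<close>
  also have "\<dots> = (\<Sum>v\<in>dyck_paths \<nu>. \<Sum>w | w \<in> schroeder_paths \<nu> \<and> expand w = v. ?x ^ count_list w Diag)"
    by (intro sum.cong refl) (auto simp: schroeder_paths_iff_expand[OF assms])
  also have "\<dots> = (\<Sum>w\<in>schroeder_paths \<nu>. ?x ^ count_list w Diag)"
    by (rule sum.group)
      (auto simp: finite_schroeder_paths finite_dyck_paths schroeder_paths_iff_expand[OF assms])
  also have "\<dots> = Sum_any (\<lambda>i. monom (int (schroeder \<nu> i)) i)"
    unfolding schroeder_def Sum_any_monom_card_fibres[OF finite_schroeder_paths] ..
  finally show ?thesis .
qed

end
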